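(* Let $\alpha^{(x)},\alpha^{(y)},\beta\in\mathbb{R}$ with $\mathrm{sign}(\alpha^{(x)})=\mathrm{sign}(\alpha^{(y)})$ and $\alpha^{(x)}\alpha^{(y)}>\beta^2$, let $\rho\in(0,\pi/2)$, $k_y\in\mathbb{R}$, and $s\in\mathbb{C}$ with $\mathrm{Re}(s)\ge0$. Let $$\lambda_{1,2}=\frac{1}{2\alpha^{(x)}}\left(-\mathrm{i}\beta k_y\pm\sqrt{-\beta^2k_y^2-4\alpha^{(x)}(\mathrm{i}s-\alpha^{(y)}k_y^2)}\right),$$ labelled so that, for $\mathrm{Re}(s)\ge 0$, the set of values of $\lambda_1$ lies in $\mathrm{Re}(\lambda)\ge0$ and contains the propagating modes with negative group velocity in $x$ (modes traveling left), while the set of values of $\lambda_2$ lies in $\mathrm{Re}(\lambda)\le0$ and contains the propagating modes with positive group velocity in $x$ (modes traveling right). Let $L_x>0$, and put $x_0=0$ for the layer $x<0$ and $x_0=L_x$ for the layer $x>L_x$. Let $\sigma_x$ be a real absorption function and let $n\in\mathbb{N}$. For $\lambda\in\{\lambda_1,\lambda_2\}$ define in each layer $$\hat u(x)=e^{\lambda x},\qquad \hat u^{\mathrm{PML}}(x)=\exp\left[\left(\lambda+\mathrm{i}\frac{\beta k_y}{2\alpha^{(x)}}\right)\left(x+e^{\mathrm{i}\rho}\int_{x_0}^x\sigma_x(\xi)\,d\xi\right)-\mathrm{i}\frac{\beta k_y}{2\alpha^{(x)}}x\right].$$ Then: (1) (Perfect matching) If $\frac{d^k}{dx^k}\sigma_x(x_0)=0$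 for all $k\le n-1$, then $\hat u$ and $\hat u^{\mathrm{PML}}$ match to order $C^n$ at $x=x_0$. (2) (Absorption) In the layers, $\partial_x\hat u^{\mathrm{PML}}=\tilde\lambda\,\hat u^{\mathrm{PML}}$ with $$\tilde\lambda=\lambda+\left(\lambda+\mathrm{i}\frac{\beta k_y}{2\alpha^{(x)}}\right)e^{\mathrm{i}\rho}\sigma_x(x),$$ and if $\sigma_x(x)>0$ for $x<0$ and $x>L_x$, then in the layers $\mathrm{Re}(\tilde\lambda)<0$ for modes traveling right in $x$ ($\lambda=\lambda_2$) and $\mathrm{Re}(\tilde\lambda)>0$ for modes traveling left in $x$ ($\lambda=\lambda_1$).
   Context: The functions $e^{\lambda x}$ with $\lambda=\lambda_{1,2}$ are the modal solutions of $(\mathrm{i}s+\alpha^{(x)}\partial_x^2-\alpha^{(y)}k_y^2+\mathrm{i}\beta k_y\partial_x)\hat u=0$, which is obtained from $\mathrm{i}\partial_tu+(\alpha^{(x)}\partial_x^2+\alpha^{(y)}\partial_y^2+\beta\partial_x\partial_y)u=0$ by Laplace transform in $t$ (dual variable $s$) and Fourier transform in $y$ (dual variable $k_y$), with zero initial data in the layers. The physical domain is $0\le x\le L_x$, $y\in\mathbb{R}$, and the layers are the regions $x<0$ and $x>L_x$. Propagating modes are $e^{\mathrm{i}(k_xx-\omega t)}$ (times the $y$-dependence) with $k_x,\omega\in\mathbb{R}$, $\lambda=\mathrm{i}k_x$, $s=-\mathrm{i}\omega$, $\omega=\alpha^{(x)}k_x^2+\alpha^{(y)}k_y^2+\beta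 k_xk_y$, and their group velocity in $x$ is $\partial\omega/\partial k_x=2\alpha^{(x)}k_x+\beta k_y$. Matching to order $C^n$ at $x_0$ means that the derivatives of orders $0,1,\dots,n$ of the two functions at $x_0$ (one-sided, from within the layer) coincide.
   Formalization: The claim fails for α^(x)<0 and when λ1=λ2: absorption is proved with e^{iρ} if α^(x)>0, with e^{-iρ} if α^(x)<0, and excludes the mode with Re λ=0 and zero group velocity; σ_x is assumed continuous on each closed layer, as the derivative formula needs. *)

theory Defs
  imports "HOL-Analysis.Analysis"
begin

section \<open>Modal solutions\<close>

definition modal_root :: "real \<Rightarrow> real \<Rightarrow> real \<Rightarrow> real \<Rightarrow> complex \<Rightarrow> complex \<Rightarrow> complex" where
  "modal_root ax ay b ky sg s =
     1 / (2 * complex_of_real ax) *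
       (- \<i> * complex_of_real (b * ky) +
        sg * csqrt (- complex_of_real (b\<^sup>2 * ky\<^sup>2)
                    - 4 * complex_of_real ax * (\<i> * s - complex_of_real (ay * ky\<^sup>2))))"

definition dispersion :: "real \<Rightarrow> real \<Rightarrow> real \<Rightarrow> real \<Rightarrow> real \<Rightarrow> real" where
  "dispersion ax ay b ky kx = ax * kx\<^sup>2 + ay * ky\<^sup>2 + b * kx * ky"

definition group_velocity :: "real \<Rightarrow> real \<Rightarrow> real \<Rightarrow> real \<Rightarrow> real \<Rightarrow> real" where
  "group_velocity ax ay b ky kx = deriv (dispersion ax ay b ky) kx"

text \<open>The labelling of the two roots, for fixed \<open>ky\<close>, as functions of \<open>s\<close> on the closed right
  half-plane. The principal branch \<^const>\<open>csqrt\<close> only serves to name the unordered pair of roots: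
  which of them is \<open>l1 s\<close> may depend on \<open>s\<close>. A propagating mode \<open>\<i> * kx\<close> solves the modal equation
  only for \<open>s = - \<i> * dispersion ax ay b ky kx\<close>, so the two inclusions of propagating modes decide
  the labelling for those \<open>s\<close> for which both roots are purely imaginary.\<close>

definition modal_labelling ::
  "real \<Rightarrow> real \<Rightarrow> real \<Rightarrow> real \<Rightarrow> (complex \<Rightarrow> complex) \<Rightarrow> (complex \<Rightarrow> complex) \<Rightarrow> bool" where
  "modal_labelling ax ay b ky l1 l2 \<longleftrightarrow>
     (\<forall>s. 0 \<le> Re s \<longrightarrow>
        (l1 s = modal_root ax ay b ky 1 s \<and> l2 s = modal_root ax ay b ky (- 1) s) \<or>
        (l1 s = modal_root ax ay b ky (- 1) s \<and> l2 s = modal_root ax ay b ky 1 s)) \<and>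
     l1 ` {s. 0 \<le> Re s} \<subseteq> {z. 0 \<le> Re z} \<and>
     {\<i> * complex_of_real kx | kx. group_velocity ax ay b ky kx < 0} \<subseteq> l1 ` {s. 0 \<le> Re s} \<and>
     l2 ` {s. 0 \<le> Re s} \<subseteq> {z. Re z \<le> 0} \<and>
     {\<i> * complex_of_real kx | kx. group_velocity ax ay b ky kx > 0} \<subseteq> l2 ` {s. 0 \<le> Re s}"

text \<open>A propagating mode of zero group velocity travels neither left nor right. It occurs exactly
  when the two roots coincide.\<close>

definition stationary_mode :: "real \<Rightarrow> real \<Rightarrow> real \<Rightarrow> real \<Rightarrow> complex \<Rightarrow> bool" where
  "stationary_mode ax ay b ky lam \<longleftrightarrow> Re lam = 0 \<and> group_velocity ax ay b ky (Im lam) = 0"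


section \<open>The layer functions\<close>

definition u_mode :: "complex \<Rightarrow> real \<Rightarrow> complex" where
  "u_mode lam x = exp (lam * complex_of_real x)"

definition u_pml ::
  "real \<Rightarrow> real \<Rightarrow> real \<Rightarrow> real \<Rightarrow> (real \<Rightarrow> real) \<Rightarrow> real \<Rightarrow> complex \<Rightarrow> real \<Rightarrow> complex" where
  "u_pml ax b ky rho sigx x0 lam x =
     exp ((lam + \<i> * complex_of_real (b * ky / (2 * ax))) *
            (complex_of_real x +
             exp (\<i> * complex_of_real rho) * complex_of_real (LBINT xi=x0..x. sigx xi))
          - \<i> * complex_of_real (b * ky / (2 * ax)) * complex_of_real x)"

definition lam_tilde ::
  "real \<Rightarrow> real \<Rightarrow> real \<Rightarrow> real \<Rightarrow> (real \<Rightarrow> real) \<Rightarrow> complex \<Rightarrow> real \<Rightarrow> complex" where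
  "lam_tilde ax b ky rho sigx lam x =
     lam + (lam + \<i> * complex_of_real (b * ky / (2 * ax))) *
             exp (\<i> * complex_of_real rho) * complex_of_real (sigx x)"

text \<open>In the application below, \<open>lamL\<close> and \<open>lamR\<close> are the left- and right-travelling modes.
  With the phase \<open>rho \<in> {0<..<pi/2}\<close> this is only attainable for \<open>ax > 0\<close>. For \<open>ax < 0\<close> a
  propagating mode with \<open>\<kappa> = Im lam + b * ky / (2 * ax)\<close> has group velocity \<open>2 * ax * \<kappa>\<close>, of the sign
  opposite to \<open>\<kappa>\<close>, while the real part of \<open>lam_tilde\<close> is \<open>- \<kappa> * sin rho * sigx x\<close>; the phase has to
  be \<open>- rho\<close> there.\<close>

definition pml_absorbs ::
  "real \<Rightarrow> real \<Rightarrow> real \<Rightarrow> real \<Rightarrow> real \<Rightarrow> (real \<Rightarrow> real) \<Rightarrow> complex \<Rightarrow> complex \<Rightarrow> real \<Rightarrow> bool" where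
  "pml_absorbs ax ay b ky rho sigx lamL lamR x \<longleftrightarrow>
     (\<not> stationary_mode ax ay b ky lamR \<longrightarrow> Re (lam_tilde ax b ky rho sigx lamR x) < 0) \<and>
     (\<not> stationary_mode ax ay b ky lamL \<longrightarrow> Re (lam_tilde ax b ky rho sigx lamL x) > 0)"


section \<open>Matching to order \<open>C\<^sup>n\<close>\<close>

definition nderiv_within ::
  "real set \<Rightarrow> nat \<Rightarrow> (real \<Rightarrow> 'a::real_normed_vector) \<Rightarrow> real \<Rightarrow> 'a" where
  "nderiv_within S k f = ((\<lambda>g x. vector_derivative g (at x within S)) ^^ k) f"

text \<open>Existence of the derivatives of orders up to \<open>n\<close> at \<open>x0\<close> from within \<open>S\<close>: those of order
  less than \<open>n\<close> must also exist at the points of \<open>S\<close> near \<open>x0\<close>.\<close>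

definition ntimes_differentiable ::
  "nat \<Rightarrow> real set \<Rightarrow> real \<Rightarrow> (real \<Rightarrow> 'a::real_normed_vector) \<Rightarrow> bool" where
  "ntimes_differentiable n S x0 f \<longleftrightarrow>
     (\<forall>k<n. nderiv_within S k f differentiable (at x0 within S)) \<and>
     (\<forall>k. Suc k < n \<longrightarrow>
        (\<forall>\<^sub>F x in at x0 within S. nderiv_within S k f differentiable (at x within S)))"

definition vanishing_derivs :: "nat \<Rightarrow> real set \<Rightarrow> real \<Rightarrow> (real \<Rightarrow> real) \<Rightarrow> bool" where
  "vanishing_derivs n S x0 f \<longleftrightarrow>
     ntimes_differentiable (n - 1) S x0 f \<and> (\<forall>k<n. nderiv_within S k f x0 = 0)"

definition matches_to_order ::
  "nat \<Rightarrow> real set \<Rightarrow> real \<Rightarrow> (real \<Rightarrow> complex) \<Rightarrow> (real \<Rightarrow> complex) \<Rightarrow> bool" where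
  "matches_to_order n S x0 f g \<longleftrightarrow>
     ntimes_differentiable n S x0 f \<and> ntimes_differentiable n S x0 g \<and>
     (\<forall>k\<le>n. nderiv_within S k f x0 = nderiv_within S k g x0)"

end

theory Submission
  imports Defs
begin

text \<open>
  Matching rests on the differential equation \<open>v' = (lam + c * sigx) * v\<close> of the layer function \<open>v\<close>,
  where \<open>c\<close> is a complex constant. The plain mode \<open>u\<close> solves the same equation with \<open>c = 0\<close> and has
  the same value at \<open>x0\<close>. If the derivatives of \<open>sigx\<close> of order less than \<open>n\<close> vanish at \<open>x0\<close>, then so
  do those of \<open>sigx * v\<close>, hence both functions have the derivatives \<open>lam ^ k * u x0\<close> there for
  \<open>k \<le> n\<close> (\<open>has_jet_linear_ode\<close>). The function \<open>sigx\<close> has one derivative less than \<open>v\<close>, and its last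
  derivative may exist at \<open>x0\<close> alone; the predicate \<open>has_jet\<close> keeps track of this without naming
  derivatives at points where they do not exist. The differential equation itself is the fundamental
  theorem of calculus on the closed layer (\<open>u_pml_has_vector_derivative_within\<close>).

  Absorption is a matter of signs. Taking imaginary parts in the modal equation, multiplied out as
  \<open>(2 * ax * lam + \<i> * b * ky)\<^sup>2 = \<dots>\<close>, gives \<open>Re lam * V = - Re s\<close>, where \<open>V\<close> is the group velocity
  at the wave number \<open>Im lam\<close> (\<open>Re_modal_root_times_group_velocity\<close>). As \<open>Re s \<ge> 0\<close>, \<open>V\<close> has
  the sign opposite to \<open>Re lam\<close>, unless one of them is zero. If \<open>Re lam = 0 \<noteq> V\<close>, the mode is
  propagating and not stationary, and the labelling fixes the sign of \<open>V\<close>, because one value can carry both labels only if the roots coincide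
  (\<open>modal_labelling_coincide\<close>). Finally \<open>Re (lam_tilde \<dots>)\<close> is a positive multiple of \<open>Re lam\<close> minus a
  multiple of \<open>V\<close> by a factor with the sign of \<open>sin th / ax\<close> (\<open>Re_lam_tilde\<close>), so that the two terms
  reinforce each other when the phase \<open>th\<close> has the sign of \<open>ax\<close>.
\<close>

section \<open>One-sided jets at a point\<close>

text \<open>The value \<open>a k\<close> prescribes the derivative of order \<open>k\<close> at \<open>x0\<close>, for \<open>k \<le> m\<close>. The derivative
  is an existential witness, so that its values at points where \<open>f\<close> is not differentiable can be
  chosen freely; this makes sums and products available by plain induction. The guard \<open>0 < m\<close>
  reflects that the derivative of highest order is demanded at \<open>x0\<close> only.\<close>

fun has_jet ::
  "real set \<Rightarrow> real \<Rightarrow> nat \<Rightarrow> (real \<Rightarrow> 'a::real_normed_vector) \<Rightarrow> (nat \<Rightarrow> 'a) \<Rightarrow> bool" where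
  "has_jet S x0 0 f a \<longleftrightarrow> f x0 = a 0"
| "has_jet S x0 (Suc m) f a \<longleftrightarrow> f x0 = a 0 \<and>
     (\<exists>f'. (f has_vector_derivative f' x0) (at x0 within S) \<and>
           (0 < m \<longrightarrow> (\<forall>\<^sub>F x in at x0 within S. (f has_vector_derivative f' x) (at x within S))) \<and>
           has_jet S x0 m f' (\<lambda>k. a (Suc k)))"

lemma has_jet_Suc_lower: "has_jet S x0 (Suc m) f a \<Longrightarrow> has_jet S x0 m f a"
proof (induction m arbitrary: f a)
  case 0
  then show ?case by simp
next
  case (Suc m)
  then obtain f' where f':
    "f x0 = a 0" "(f has_vector_derivative f' x0) (at x0 within S)"
    "\<forall>\<^sub>F x in at x0 within S. (f has_vector_derivative f' x) (at x within S)"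
    "has_jet S x0 (Suc m) f' (\<lambda>k. a (Suc k))"
    by (subst (asm) has_jet.simps) blast
  from Suc.IH[OF f'(4)] f'(1-3) show ?case
    by (simp only: has_jet.simps) blast
qed

lemma has_jet_zero: "has_jet S x0 m (\<lambda>_. 0) (\<lambda>_. 0)"
  by (induction m) (auto intro!: exI[of _ "\<lambda>_. 0"])

lemma has_jet_add:
  "has_jet S x0 m f a \<Longrightarrow> has_jet S x0 m g b \<Longrightarrow>
   has_jet S x0 m (\<lambda>x. f x + g x) (\<lambda>k. a k + b k)"
proof (induction m arbitrary: f g a b)
  case 0
  then show ?case by simp
next
  case (Suc m)
  from Suc.prems(1) obtain f' where f':
    "f x0 = a 0" "(f has_vector_derivative f' x0) (at x0 within S)"
    "0 < m \<longrightarrow> (\<forall>\<^sub>F x in at x0 within S. (f has_vector_derivative f' x) (at x within S))"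
    "has_jet S x0 m f' (\<lambda>k. a (Suc k))"
    by auto
  from Suc.prems(2) obtain g' where g':
    "g x0 = b 0" "(g has_vector_derivative g' x0) (at x0 within S)"
    "0 < m \<longrightarrow> (\<forall>\<^sub>F x in at x0 within S. (g has_vector_derivative g' x) (at x within S))"
    "has_jet S x0 m g' (\<lambda>k. b (Suc k))"
    by auto
  have "0 < m \<longrightarrow> (\<forall>\<^sub>F x in at x0 within S.
      ((\<lambda>x. f x + g x) has_vector_derivative f' x + g' x) (at x within S))"
  proof
    assume "0 < m"
    show "\<forall>\<^sub>F x in at x0 within S.
        ((\<lambda>x. f x + g x) has_vector_derivative f' x + g' x) (at x within S)"
      using f'(3)[rule_format, OF \<open>0 < m\<close>] g'(3)[rule_format, OF \<open>0 < m\<close>]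
      by (rule eventually_elim2) (rule has_vector_derivative_add)
  qed
  then show ?case
    using f' g' Suc.IH[OF f'(4) g'(4)]
    by (auto intro!: exI[of _ "\<lambda>x. f' x + g' x"] has_vector_derivative_add)
qed

lemma (in bounded_linear) has_jet:
  "has_jet S x0 m g a \<Longrightarrow> has_jet S x0 m (\<lambda>x. f (g x)) (\<lambda>k. f (a k))"
proof (induction m arbitrary: g a)
  case 0
  then show ?case by simp
next
  case (Suc m)
  then obtain g' where g':
    "g x0 = a 0" "(g has_vector_derivative g' x0) (at x0 within S)"
    "0 < m \<longrightarrow> (\<forall>\<^sub>F x in at x0 within S. (g has_vector_derivative g' x) (at x within S))"
    "has_jet S x0 m g' (\<lambda>k. a (Suc k))"
    by auto
  have "0 < m \<longrightarrow> (\<forall>\<^sub>F x in at x0 within S.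
      ((\<lambda>x. f (g x)) has_vector_derivative f (g' x)) (at x within S))"
    using g'(3) by (auto elim!: eventually_mono intro: has_vector_derivative)
  then show ?case
    using g' Suc.IH[OF g'(4)]
    by (auto intro!: exI[of _ "\<lambda>x. f (g' x)"] has_vector_derivative)
qed

text \<open>By the Leibniz rule every derivative of the product is a sum of terms each containing a derivative
  of \<open>f\<close>. The induction needs just one step of that rule, since both summands are again products with
  a flat left factor.\<close>

lemma (in bounded_bilinear) has_jet_flat_left:
  "has_jet S x0 m f (\<lambda>_. 0) \<Longrightarrow> has_jet S x0 m g b \<Longrightarrow>
   has_jet S x0 m (\<lambda>x. prod (f x) (g x)) (\<lambda>_. 0)"
proof (induction m arbitrary: f g b)
  case 0
  then show ?case by (simp add: zero_left)
next
  case (Suc m)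
  from Suc.prems(1) obtain f' where f':
    "f x0 = 0" "(f has_vector_derivative f' x0) (at x0 within S)"
    "0 < m \<longrightarrow> (\<forall>\<^sub>F x in at x0 within S. (f has_vector_derivative f' x) (at x within S))"
    "has_jet S x0 m f' (\<lambda>_. 0)"
    by auto
  from Suc.prems(2) obtain g' where g':
    "(g has_vector_derivative g' x0) (at x0 within S)"
    "0 < m \<longrightarrow> (\<forall>\<^sub>F x in at x0 within S. (g has_vector_derivative g' x) (at x within S))"
    "has_jet S x0 m g' (\<lambda>k. b (Suc k))"
    by auto
  let ?h = "\<lambda>x. prod (f x) (g' x) + prod (f' x) (g x)"
  have "0 < m \<longrightarrow> (\<forall>\<^sub>F x in at x0 within S.
      ((\<lambda>x. prod (f x) (g x)) has_vector_derivative ?h x) (at x within S))"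
  proof
    assume "0 < m"
    show "\<forall>\<^sub>F x in at x0 within S.
        ((\<lambda>x. prod (f x) (g x)) has_vector_derivative ?h x) (at x within S)"
      using f'(3)[rule_format, OF \<open>0 < m\<close>] g'(2)[rule_format, OF \<open>0 < m\<close>]
      by (rule eventually_elim2) (rule has_vector_derivative)
  qed
  moreover have "((\<lambda>x. prod (f x) (g x)) has_vector_derivative ?h x0) (at x0 within S)"
    by (rule has_vector_derivative[OF f'(2) g'(1)])
  moreover have "has_jet S x0 m ?h (\<lambda>_. 0)"
    using has_jet_add[OF Suc.IH[OF has_jet_Suc_lower[OF Suc.prems(1)] g'(3)]
        Suc.IH[OF f'(4) has_jet_Suc_lower[OF Suc.prems(2)]]]
    by simp
  ultimately show ?case
    using f'(1) by (auto simp: zero_left intro!: exI[of _ ?h])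
qed

lemma eventually_within_nhds:
  assumes "\<forall>\<^sub>F x in at x0 within S. P x" and "P x0"
  shows "\<forall>\<^sub>F y in at x0 within S. P y \<and> (\<forall>\<^sub>F x in at y within S. P x)"
proof -
  have "\<forall>\<^sub>F x in nhds x0. x \<in> S \<longrightarrow> P x"
    using assms by (auto simp: eventually_at_filter elim!: eventually_mono)
  then have "\<forall>\<^sub>F y in nhds x0. (y \<in> S \<longrightarrow> P y) \<and> (\<forall>\<^sub>F x in nhds y. x \<in> S \<longrightarrow> P x)"
    using eventually_eventually[of "\<lambda>x. x \<in> S \<longrightarrow> P x" x0]
    by (simp add: eventually_conj_iff)
  then show ?thesis
    unfolding eventually_at_filter by (auto elim!: eventually_mono)
qed

text \<open>For \<open>m = 0\<close> only the value at \<open>x0\<close> enters, so the two functions may differ at all other points.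
  This weak form is what the comparison of a derivative \<open>f'\<close> existing at \<open>x0\<close> alone with
  \<^const>\<open>vector_derivative\<close> requires.\<close>

lemma has_jet_cong:
  assumes jet: "has_jet S x0 m f a" and "x0 \<in> S" and "f x0 = g x0"
    and near: "0 < m \<Longrightarrow> \<forall>\<^sub>F x in at x0 within S. f x = g x"
  shows "has_jet S x0 m g a"
proof (cases m)
  case 0
  then show ?thesis using assms by simp
next
  case (Suc p)
  from jet obtain f' where f':
    "f x0 = a 0" "(f has_vector_derivative f' x0) (at x0 within S)"
    "0 < p \<longrightarrow> (\<forall>\<^sub>F x in at x0 within S. (f has_vector_derivative f' x) (at x within S))"
    "has_jet S x0 p f' (\<lambda>k. a (Suc k))"
    unfolding Suc by auto
  have trans: "(g has_vector_derivative d) (at x within S)"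
    if "(f has_vector_derivative d) (at x within S)" "\<forall>\<^sub>F y in at x within S. f y = g y"
      "f x = g x" "x \<in> S" for x d
    using that unfolding has_vector_derivative_def
    by (intro has_derivative_transform_eventually[of f _ x S g])
  have ev: "\<forall>\<^sub>F x in at x0 within S. f x = g x"
    using near Suc by simp
  have "(g has_vector_derivative f' x0) (at x0 within S)"
    using trans[OF f'(2) ev] assms by simp
  moreover have "0 < p \<longrightarrow>
      (\<forall>\<^sub>F x in at x0 within S. (g has_vector_derivative f' x) (at x within S))"
  proof
    assume "0 < p"
    have "\<forall>\<^sub>F x in at x0 within S. x \<in> S"
      by (simp add: eventually_at_filter)
    with f'(3)[rule_format, OF \<open>0 < p\<close>] eventually_within_nhds[OF ev \<open>f x0 = g x0\<close>]
    show "\<forall>\<^sub>F x in at x0 within S. (g has_vector_derivative f' x) (at x within S)"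
      by eventually_elim (blast intro: trans)
  qed
  ultimately show ?thesis
    using f' assms(3) Suc by auto
qed

section \<open>Jets and iterated derivatives\<close>

lemma nderiv_within_Suc:
  "nderiv_within S (Suc k) f = nderiv_within S k (\<lambda>x. vector_derivative f (at x within S))"
  unfolding nderiv_within_def by (subst funpow_Suc_right) simp

lemma ntimes_differentiable_Suc:
  "ntimes_differentiable (Suc m) S x0 f \<longleftrightarrow>
     f differentiable (at x0 within S) \<and>
     (0 < m \<longrightarrow> (\<forall>\<^sub>F x in at x0 within S. f differentiable (at x within S))) \<and>
     ntimes_differentiable m S x0 (\<lambda>x. vector_derivative f (at x within S))"
proof -
  have split: "(\<forall>k. Suc k < Suc m \<longrightarrow> Q k) \<longleftrightarrow> (0 < m \<longrightarrow> Q 0) \<and> (\<forall>k. Suc k < m \<longrightarrow> Q (Suc k))"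
    for Q :: "nat \<Rightarrow> bool"
    by (metis Suc_less_eq not0_implies_Suc)
  have nd0: "nderiv_within S 0 f = f"
    by (simp add: nderiv_within_def)
  show ?thesis
    unfolding ntimes_differentiable_def split All_less_Suc2 nd0 nderiv_within_Suc by blast
qed

lemma has_jet_iff_nderiv:
  assumes "x0 \<in> S" and perfect: "\<And>x. x \<in> S \<Longrightarrow> x islimpt S"
  shows "has_jet S x0 m f a \<longleftrightarrow>
    ntimes_differentiable m S x0 f \<and> (\<forall>k\<le>m. nderiv_within S k f x0 = a k)"
proof (induction m arbitrary: f a)
  case 0
  then show ?case by (simp add: ntimes_differentiable_def nderiv_within_def)
next
  case (Suc m)
  let ?d = "\<lambda>x. vector_derivative f (at x within S)"
  have nontriv: "at x within S \<noteq> bot" if "x \<in> S" for x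
    using perfect[OF that] trivial_limit_within by blast
  have d_eq: "d = ?d x" if "(f has_vector_derivative d) (at x within S)" "x \<in> S" for d x
    using vector_derivative_within[OF nontriv that(1)] that(2) by simp
  have d_ex: "f differentiable (at x within S) \<longleftrightarrow>
      (f has_vector_derivative ?d x) (at x within S)" for x
    by (metis differentiableI_vector vector_derivative_works)
  have inS: "\<forall>\<^sub>F x in at x0 within S. x \<in> S"
    by (simp add: eventually_at_filter)
  have "has_jet S x0 (Suc m) f a \<longleftrightarrow> f x0 = a 0 \<and>
      (f has_vector_derivative ?d x0) (at x0 within S) \<and>
      (0 < m \<longrightarrow> (\<forall>\<^sub>F x in at x0 within S. (f has_vector_derivative ?d x) (at x within S))) \<and>
      has_jet S x0 m ?d (\<lambda>k. a (Suc k))" (is "?L \<longleftrightarrow> ?R")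
  proof
    assume ?L
    then obtain f' where f':
      "f x0 = a 0" "(f has_vector_derivative f' x0) (at x0 within S)"
      "0 < m \<longrightarrow> (\<forall>\<^sub>F x in at x0 within S. (f has_vector_derivative f' x) (at x within S))"
      "has_jet S x0 m f' (\<lambda>k. a (Suc k))"
      by auto
    have at: "f' x0 = ?d x0"
      using d_eq[OF f'(2) \<open>x0 \<in> S\<close>] .
    have near: "\<forall>\<^sub>F x in at x0 within S. f' x = ?d x \<and>
        (f has_vector_derivative f' x) (at x within S)" if "0 < m"
      using f'(3)[rule_format, OF that] inS by (rule eventually_elim2) (auto dest: d_eq)
    have "has_jet S x0 m ?d (\<lambda>k. a (Suc k))"
      by (rule has_jet_cong[where g = ?d, OF f'(4) \<open>x0 \<in> S\<close> at])
        (auto elim: eventually_mono dest!: near)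
    moreover have "0 < m \<longrightarrow>
        (\<forall>\<^sub>F x in at x0 within S. (f has_vector_derivative ?d x) (at x within S))"
      by (auto elim: eventually_mono dest!: near)
    ultimately show ?R using f' at by simp
  next
    assume ?R
    then show ?L by (auto intro!: exI[of _ ?d])
  qed
  moreover have "(\<forall>k\<le>Suc m. nderiv_within S k f x0 = a k) \<longleftrightarrow>
      f x0 = a 0 \<and> (\<forall>k\<le>m. nderiv_within S k ?d x0 = a (Suc k))"
    unfolding All_less_Suc2 less_Suc_eq_le[symmetric] nderiv_within_Suc
    by (simp add: nderiv_within_def)
  ultimately show ?case
    unfolding Suc.IH ntimes_differentiable_Suc d_ex by blast
qed

text \<open>The equation turns a jet of order \<open>m\<close> of \<open>u\<close> into one of order \<open>m + 1\<close>: the flat coefficient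
  \<open>sig\<close> makes the second term contribute nothing, so the derivatives at \<open>x0\<close> satisfy the same
  recursion as those of \<open>exp (lam * x)\<close>. A jet of \<open>sig\<close> of order \<open>n - 1\<close> is enough to reach order \<open>n\<close>.\<close>

lemma has_jet_linear_ode:
  fixes u :: "real \<Rightarrow> complex" and sig :: "real \<Rightarrow> real"
  assumes "x0 \<in> S"
    and ode: "\<And>x. x \<in> S \<Longrightarrow>
      (u has_vector_derivative lam * u x + sig x *\<^sub>R (c * u x)) (at x within S)"
    and flat: "\<And>m. m < n \<Longrightarrow> has_jet S x0 m sig (\<lambda>_. 0)"
  shows "has_jet S x0 n u (\<lambda>k. lam ^ k * u x0)"
  using flat
proof (induction n)
  case 0
  then show ?case by simp
next
  case (Suc m)
  have jet: "has_jet S x0 m u (\<lambda>k. lam ^ k * u x0)"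
    using Suc by simp
  have "has_jet S x0 m (\<lambda>x. sig x *\<^sub>R (c * u x)) (\<lambda>_. 0)"
    by (rule bounded_bilinear.has_jet_flat_left[OF bounded_bilinear_scaleR Suc.prems
          bounded_linear.has_jet[OF bounded_linear_mult_right jet]]) simp
  from has_jet_add[OF bounded_linear.has_jet[OF bounded_linear_mult_right[of lam] jet] this]
  have rhs: "has_jet S x0 m (\<lambda>x. lam * u x + sig x *\<^sub>R (c * u x)) (\<lambda>k. lam ^ Suc k * u x0)"
    by (simp add: mult.assoc)
  have "\<forall>\<^sub>F x in at x0 within S.
      (u has_vector_derivative lam * u x + sig x *\<^sub>R (c * u x)) (at x within S)"
    using ode by (simp add: eventually_at_filter)
  with rhs ode[OF \<open>x0 \<in> S\<close>] show ?case
    by (auto intro!: exI[of _ "\<lambda>x. lam * u x + sig x *\<^sub>R (c * u x)"])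
qed

section \<open>The layer function and its differential equation\<close>

text \<open>The fundamental theorem is local, so the interval \<open>S\<close>, possibly unbounded, can be replaced by a
  compact interval in it that contains \<open>x0\<close> and agrees with \<open>S\<close> near \<open>x\<close>.\<close>

lemma LBINT_has_vector_derivative_interval:
  fixes f :: "real \<Rightarrow> real"
  assumes "is_interval S" and "x0 \<in> S" and "x \<in> S" and "continuous_on S f"
  shows "((\<lambda>u. LBINT y=x0..u. f y) has_vector_derivative f x) (at x within S)"
proof -
  obtain p q where pq: "p \<in> S" "q \<in> S" "p \<le> x0" "x0 \<le> q" "p \<le> x" "x \<le> q"
    "at x within S = at x within {p..q}"
  proof -
    \<comment> \<open>\<open>p\<close> lies strictly to the left of \<open>x\<close> unless \<open>x\<close> is the least point of \<open>S\<close>; in either case no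
      point of \<open>S\<close> above \<open>a\<close> is lost. The point \<open>q\<close> plays the same role on the right.\<close>
    obtain p a where p: "p \<in> S" "p \<le> x0" "p \<le> x" "a < x" "\<And>z. z \<in> S \<Longrightarrow> a < z \<Longrightarrow> p \<le> z"
    proof (cases "\<exists>y\<in>S. y < x")
      case True
      then obtain y where "y \<in> S" "y < x" by blast
      with that[of "min x0 y" y] show ?thesis using \<open>x0 \<in> S\<close> by (auto simp: min_def)
    next
      case False
      then have "x \<le> z" if "z \<in> S" for z using that by force
      with that[of x "x - 1"] show ?thesis using assms by simp
    qed
    obtain q c where q: "q \<in> S" "x0 \<le> q" "x \<le> q" "x < c" "\<And>z. z \<in> S \<Longrightarrow> z < c \<Longrightarrow> z \<le> q"
    proof (cases "\<exists>y\<in>S. x < y")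
      case True
      then obtain y where "y \<in> S" "x < y" by blast
      with that[of "max x0 y" y] show ?thesis using \<open>x0 \<in> S\<close> by (auto simp: max_def)
    next
      case False
      then have "z \<le> x" if "z \<in> S" for z using that by force
      with that[of x "x + 1"] show ?thesis using assms by simp
    qed
    have between: "z \<in> S" if "p \<le> z" "z \<le> q" for z
      using \<open>is_interval S\<close> p(1) q(1) that unfolding is_interval_1 by blast
    have "z \<in> S \<longleftrightarrow> z \<in> {p..q}" if "a < z" "z < c" for z
      using between[of z] p(5)[of z] q(5)[of z] that by fastforce
    then have "S \<inter> {a<..<c} - {x} = {p..q} \<inter> {a<..<c} - {x}"
      unfolding set_eq_iff Int_iff Diff_iff greaterThanLessThan_iff by blast
    then have "at x within S = at x within {p..q}"
      by (intro at_within_nhd[of x "{a<..<c}"]) (use p(4) q(4) in auto)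
    then show ?thesis
      using that[of p q] p(1-3) q(1-3) by blast
  qed
  have sub: "{p..q} \<subseteq> S"
    using \<open>is_interval S\<close> pq(1,2) unfolding is_interval_1 subset_iff atLeastAtMost_iff by blast
  show ?thesis
    unfolding pq(7)
    by (rule interval_integral_FTC2[OF pq(3,4) continuous_on_subset[OF assms(4) sub]])
      (use pq in simp_all)
qed

lemma u_pml_has_vector_derivative_within:
  assumes "is_interval S" and "x0 \<in> S" and "x \<in> S" and cont: "continuous_on S sigx"
  shows "(u_pml ax b ky th sigx x0 lam has_vector_derivative
     lam_tilde ax b ky th sigx lam x * u_pml ax b ky th sigx x0 lam x) (at x within S)"
proof -
  define I where "I x = (LBINT xi=x0..x. sigx xi)" for x :: real
  have I: "(I has_real_derivative sigx x) (at x within S)"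
    using LBINT_has_vector_derivative_interval[OF assms]
    by (simp add: I_def[abs_def] has_real_derivative_iff_has_vector_derivative)
  have I': "((\<lambda>x. complex_of_real (I x)) has_vector_derivative complex_of_real (sigx x))
      (at x within S)"
    using I by (rule has_vector_derivative_of_real)
  define k where "k = \<i> * complex_of_real (b * ky / (2 * ax))"
  define e where "e = exp (\<i> * complex_of_real th)"
  define E where "E x = (lam + k) * (complex_of_real x + e * complex_of_real (I x))
      - k * complex_of_real x" for x
  have "(E has_vector_derivative (lam + k) * (1 + e * complex_of_real (sigx x)) - k * 1)
      (at x within S)"
    unfolding E_def
    by (intro has_vector_derivative_diff has_vector_derivative_mult_right
        has_vector_derivative_add I' has_vector_derivative_of_real[of "\<lambda>x. x" 1, simplified]
        DERIV_ident)
  from field_vector_diff_chain_within[OF this, of exp "exp (E x)"]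
  have "((exp \<circ> E) has_vector_derivative
      ((lam + k) * (1 + e * complex_of_real (sigx x)) - k) * exp (E x)) (at x within S)"
    by (simp add: DERIV_exp has_field_derivative_at_within)
  moreover have "exp \<circ> E = u_pml ax b ky th sigx x0 lam"
    by (auto simp: fun_eq_iff E_def u_pml_def k_def e_def I_def)
  moreover have "(lam + k) * (1 + e * complex_of_real (sigx x)) - k
      = lam_tilde ax b ky th sigx lam x"
    unfolding lam_tilde_def k_def[symmetric] e_def[symmetric] by (simp add: algebra_simps)
  ultimately show ?thesis
    by (metis comp_apply)
qed

lemma u_pml_matches:
  assumes "is_interval S" and perfect: "\<And>x. x \<in> S \<Longrightarrow> x islimpt S" and "x0 \<in> S"
    and cont: "continuous_on S sigx" and van: "vanishing_derivs n S x0 sigx"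
  shows "matches_to_order n S x0 (u_mode lam) (u_pml ax b ky th sigx x0 lam)"
proof -
  define v where "v = u_pml ax b ky th sigx x0 lam"
  define c where "c = (lam + \<i> * complex_of_real (b * ky / (2 * ax))) * exp (\<i> * complex_of_real th)"
  have start: "v x0 = u_mode lam x0"
    unfolding v_def u_pml_def u_mode_def by (simp add: algebra_simps)
  have top: "has_jet S x0 (n - 1) sigx (\<lambda>_. 0)" if "0 < n"
  proof -
    have "\<forall>k\<le>n - 1. nderiv_within S k sigx x0 = 0"
      using van that unfolding vanishing_derivs_def by simp
    then show ?thesis
      using van has_jet_iff_nderiv[OF \<open>x0 \<in> S\<close> perfect, of "n - 1" sigx "\<lambda>_. 0"]
      unfolding vanishing_derivs_def by blast
  qed
  have flat: "has_jet S x0 m sigx (\<lambda>_. 0)" if "m < n" for m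
  proof -
    have "m \<le> n - 1" using that by simp
    then show ?thesis
    proof (induction rule: inc_induct)
      case base
      then show ?case using top that by simp
    next
      case (step k)
      show ?case by (rule has_jet_Suc_lower[OF step.IH])
    qed
  qed
  have "has_jet S x0 n v (\<lambda>k. lam ^ k * v x0)"
  proof (rule has_jet_linear_ode[OF \<open>x0 \<in> S\<close> _ flat])
    show "(v has_vector_derivative lam * v x + sigx x *\<^sub>R (c * v x)) (at x within S)"
      if "x \<in> S" for x
      using u_pml_has_vector_derivative_within[OF assms(1,3) that cont, of ax b ky th lam]
      by (simp add: v_def c_def lam_tilde_def scaleR_conv_of_real algebra_simps)
  qed
  moreover have "has_jet S x0 n (u_mode lam) (\<lambda>k. lam ^ k * u_mode lam x0)"
  proof (rule has_jet_linear_ode[OF \<open>x0 \<in> S\<close> _ has_jet_zero])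
    show "(u_mode lam has_vector_derivative
        lam * u_mode lam x + 0 *\<^sub>R (0 * u_mode lam x)) (at x within S)" for x
      unfolding u_mode_def
      by (auto intro!: derivative_eq_intros has_vector_derivative_real_field)
  qed
  moreover have "has_jet S x0 n f a \<longleftrightarrow>
      ntimes_differentiable n S x0 f \<and> (\<forall>k\<le>n. nderiv_within S k f x0 = a k)"
    for f :: "real \<Rightarrow> complex" and a
    by (rule has_jet_iff_nderiv[OF \<open>x0 \<in> S\<close> perfect])
  ultimately show ?thesis
    unfolding matches_to_order_def v_def[symmetric] start by simp
qed

section \<open>Group velocity and absorption\<close>

lemma group_velocity_eq:
  "group_velocity ax ay b ky kx = 2 * ax * kx + b * ky"
  unfolding group_velocity_def dispersion_def
  by (rule DERIV_imp_deriv) (auto intro!: derivative_eq_intros)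

lemma modal_root_shifted:
  assumes "ax \<noteq> 0"
  shows "2 * of_real ax * modal_root ax ay b ky sg s + \<i> * of_real (b * ky) =
    sg * csqrt (- complex_of_real (b\<^sup>2 * ky\<^sup>2)
      - 4 * complex_of_real ax * (\<i> * s - complex_of_real (ay * ky\<^sup>2)))"
  using assms unfolding modal_root_def by simp

lemma modal_root_shifted_sq:
  assumes "ax \<noteq> 0" and "lam = modal_root ax ay b ky sg s" and "sg\<^sup>2 = 1"
  shows "(2 * of_real ax * lam + \<i> * of_real (b * ky))\<^sup>2 =
    - complex_of_real (b\<^sup>2 * ky\<^sup>2)
      - 4 * complex_of_real ax * (\<i> * s - complex_of_real (ay * ky\<^sup>2))"
  unfolding assms(2) modal_root_shifted[OF assms(1)] power_mult_distrib assms(3) by simp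

text \<open>The number \<open>2 * ax * lam + \<i> * b * ky\<close> has real part \<open>2 * ax * Re lam\<close> and its imaginary part is
  the group velocity. The identity is the imaginary part of its square.\<close>

lemma Re_modal_root_times_group_velocity:
  assumes "ax \<noteq> 0" and "lam = modal_root ax ay b ky sg s" and "sg\<^sup>2 = 1"
  shows "Re lam * group_velocity ax ay b ky (Im lam) = - Re s"
proof -
  have "Im ((2 * of_real ax * lam + \<i> * of_real (b * ky))\<^sup>2) = - 4 * ax * Re s"
    unfolding modal_root_shifted_sq[OF assms] by simp
  moreover have "Im ((2 * of_real ax * lam + \<i> * of_real (b * ky))\<^sup>2) =
      4 * ax * (Re lam * group_velocity ax ay b ky (Im lam))"
    by (simp add: Im_power2 group_velocity_eq algebra_simps)
  ultimately have "4 * ax * (Re lam * group_velocity ax ay b ky (Im lam)) = 4 * ax * (- Re s)"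
    by simp
  then show ?thesis using assms(1) unfolding mult_cancel_left by simp
qed

lemma modal_labelling_cases:
  assumes "modal_labelling ax ay b ky l1 l2" and "0 \<le> Re s"
  obtains sg where "sg\<^sup>2 = 1" "l1 s = modal_root ax ay b ky sg s"
    "l2 s = modal_root ax ay b ky (- sg) s"
proof -
  have "(l1 s = modal_root ax ay b ky 1 s \<and> l2 s = modal_root ax ay b ky (- 1) s) \<or>
      (l1 s = modal_root ax ay b ky (- 1) s \<and> l2 s = modal_root ax ay b ky 1 s)"
    using assms unfolding modal_labelling_def by blast
  then show thesis
    using that[of 1] that[of "- 1"] by auto
qed

text \<open>The common value determines the Laplace variable through the modal equation, so \<open>s = t\<close>. Then
  the two roots for this \<open>s\<close> are equal, so the square root by which they differ vanishes. Up to sign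
  it is \<open>2 * ax * l1 s + \<i> * b * ky\<close>, whose imaginary part is the group velocity.\<close>

lemma modal_labelling_coincide:
  assumes ax: "ax \<noteq> 0" and lab: "modal_labelling ax ay b ky l1 l2"
    and s: "0 \<le> Re s" and t: "0 \<le> Re t" and eq: "l1 s = l2 t"
  shows "group_velocity ax ay b ky (Im (l1 s)) = 0"
proof -
  obtain sg where sg: "sg\<^sup>2 = 1" "l1 s = modal_root ax ay b ky sg s"
    "l2 s = modal_root ax ay b ky (- sg) s"
    using modal_labelling_cases[OF lab s] .
  obtain sg' where sg': "sg'\<^sup>2 = 1" "l1 t = modal_root ax ay b ky sg' t"
    "l2 t = modal_root ax ay b ky (- sg') t"
    using modal_labelling_cases[OF lab t] .
  have "s = t"
    using modal_root_shifted_sq[OF ax sg(2,1)] modal_root_shifted_sq[OF ax sg'(3)] sg'(1) eq ax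
    by simp
  with eq have "l1 s = l2 s" by simp
  then have "2 * of_real ax * l1 s + \<i> * of_real (b * ky)
      = - (2 * of_real ax * l1 s + \<i> * of_real (b * ky))"
    using modal_root_shifted[OF ax, of ay b ky sg s] modal_root_shifted[OF ax, of ay b ky "- sg" s] sg
    by simp
  moreover have "z = 0" if "z = - z" for z :: complex
    using that by (auto simp: complex_eq_iff)
  ultimately have "2 * of_real ax * l1 s + \<i> * of_real (b * ky) = 0"
    by blast
  then have "Im (2 * of_real ax * l1 s + \<i> * of_real (b * ky)) = 0" by simp
  then show ?thesis by (simp add: group_velocity_eq)
qed

text \<open>If \<open>Re (l1 s) = 0\<close> and the group velocity were positive, then \<open>l1 s\<close> would be a right-travelling
  mode, hence also a value of \<open>l2\<close>.\<close>

lemma modal_labelling_left: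
  assumes ax: "ax \<noteq> 0" and lab: "modal_labelling ax ay b ky l1 l2" and s: "0 \<le> Re s"
    and nonstat: "\<not> stationary_mode ax ay b ky (l1 s)"
  shows "0 \<le> Re (l1 s)" and "group_velocity ax ay b ky (Im (l1 s)) \<le> 0"
    and "0 < Re (l1 s) \<or> group_velocity ax ay b ky (Im (l1 s)) < 0"
proof -
  let ?V = "group_velocity ax ay b ky (Im (l1 s))"
  show re: "0 \<le> Re (l1 s)"
    using lab s unfolding modal_labelling_def by blast
  obtain sg where "sg\<^sup>2 = 1" "l1 s = modal_root ax ay b ky sg s"
    using modal_labelling_cases[OF lab s] .
  from Re_modal_root_times_group_velocity[OF ax this(2,1)] s
  have prod: "Re (l1 s) * ?V \<le> 0" by simp
  have "?V < 0" if "Re (l1 s) = 0"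
  proof (rule ccontr)
    assume "\<not> ?V < 0"
    with nonstat that have "0 < ?V" by (auto simp: stationary_mode_def)
    moreover have "l1 s = \<i> * complex_of_real (Im (l1 s))"
      using that by (simp add: complex_eq_iff)
    ultimately have "l1 s \<in> l2 ` {s. 0 \<le> Re s}"
      using lab unfolding modal_labelling_def by blast
    then obtain t where "0 \<le> Re t" "l1 s = l2 t" by auto
    with modal_labelling_coincide[OF ax lab s] \<open>0 < ?V\<close> show False by simp
  qed
  with re prod show "?V \<le> 0" and "0 < Re (l1 s) \<or> ?V < 0"
    by (auto simp: mult_le_0_iff less_le)
qed

lemma modal_labelling_right:
  assumes ax: "ax \<noteq> 0" and lab: "modal_labelling ax ay b ky l1 l2" and s: "0 \<le> Re s"
    and nonstat: "\<not> stationary_mode ax ay b ky (l2 s)"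
  shows "Re (l2 s) \<le> 0" and "0 \<le> group_velocity ax ay b ky (Im (l2 s))"
    and "Re (l2 s) < 0 \<or> 0 < group_velocity ax ay b ky (Im (l2 s))"
proof -
  let ?V = "group_velocity ax ay b ky (Im (l2 s))"
  show re: "Re (l2 s) \<le> 0"
    using lab s unfolding modal_labelling_def by blast
  obtain sg where "sg\<^sup>2 = 1" "l2 s = modal_root ax ay b ky (- sg) s"
    using modal_labelling_cases[OF lab s] .
  then have prod: "Re (l2 s) * ?V \<le> 0"
    using Re_modal_root_times_group_velocity[OF ax, of "l2 s" ay b ky "- sg" s] s by simp
  have "0 < ?V" if "Re (l2 s) = 0"
  proof (rule ccontr)
    assume "\<not> 0 < ?V"
    with nonstat that have "?V < 0" by (auto simp: stationary_mode_def)
    moreover have "l2 s = \<i> * complex_of_real (Im (l2 s))"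
      using that by (simp add: complex_eq_iff)
    ultimately have "l2 s \<in> l1 ` {s. 0 \<le> Re s}"
      using lab unfolding modal_labelling_def by blast
    then obtain t where t: "0 \<le> Re t" "l1 t = l2 s" by auto
    with modal_labelling_coincide[OF ax lab t(1) s t(2)] \<open>?V < 0\<close> show False by simp
  qed
  with re prod show "0 \<le> ?V" and "Re (l2 s) < 0 \<or> 0 < ?V"
    by (auto simp: mult_le_0_iff less_le)
qed

text \<open>The shift by \<open>\<i> * b * ky / (2 * ax)\<close> in the layer gives the factor that multiplies \<open>sigx\<close> the
  imaginary part \<open>V / (2 * ax)\<close>, with \<open>V\<close> the group velocity, in place of the wave number \<open>Im lam\<close>,
  whose sign need not agree with the direction of travel.\<close>

lemma Re_lam_tilde:
  assumes "ax \<noteq> 0"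
  shows "Re (lam_tilde ax b ky th sigx lam x) =
    Re lam * (1 + cos th * sigx x)
      - group_velocity ax ay b ky (Im lam) * (sin th / (2 * ax) * sigx x)"
  using assms
  by (simp add: lam_tilde_def group_velocity_eq exp_Euler cos_of_real sin_of_real field_simps)

lemma pml_absorbsI:
  assumes ax: "ax \<noteq> 0" and "modal_labelling ax ay b ky l1 l2" and "0 \<le> Re s"
    and "0 < cos th" and "0 < sin th / ax" and "0 < sigx x"
  shows "pml_absorbs ax ay b ky th sigx (l1 s) (l2 s) x"
proof -
  define P where "P = 1 + cos th * sigx x"
  define Q where "Q = sin th / (2 * ax) * sigx x"
  have "0 < P"
    using assms(4,6) by (simp add: P_def add_pos_pos)
  have "0 < Q"
    using mult_pos_pos[OF assms(5,6)] by (simp add: Q_def)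
  have decay: "p * P - v * Q < 0" if "p \<le> 0" "0 \<le> v" "p < 0 \<or> 0 < v" for p v
  proof (cases "p < 0")
    case True
    then have "p * P < 0" "0 \<le> v * Q"
      using that \<open>0 < P\<close> \<open>0 < Q\<close> by (simp_all add: mult_neg_pos)
    then show ?thesis by linarith
  next
    case False
    then have "p = 0" "0 < v * Q"
      using that \<open>0 < Q\<close> by simp_all
    then show ?thesis by simp
  qed
  have "Re (lam_tilde ax b ky th sigx (l2 s) x) < 0"
    if "\<not> stationary_mode ax ay b ky (l2 s)"
    using decay[OF modal_labelling_right[OF assms(1-3) that]]
    unfolding Re_lam_tilde[OF ax, of b ky th sigx _ x ay] P_def Q_def .
  moreover have "0 < Re (lam_tilde ax b ky th sigx (l1 s) x)"
    if "\<not> stationary_mode ax ay b ky (l1 s)"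
    using decay[of "- Re (l1 s)" "- group_velocity ax ay b ky (Im (l1 s))"]
      modal_labelling_left[OF assms(1-3) that]
    unfolding Re_lam_tilde[OF ax, of b ky th sigx _ x ay] P_def Q_def by simp
  ultimately show ?thesis by (simp add: pml_absorbs_def)
qed

section \<open>Perfect matching and absorption\<close>

theorem mainTheorem3:
  fixes ax ay b rho ky Lx :: real
    and s :: complex
    and lam1 lam2 :: "complex \<Rightarrow> complex"
    and sigx :: "real \<Rightarrow> real"
    and n :: nat
  assumes "sgn ax = sgn ay" and "ax * ay > b\<^sup>2"
    and "0 < rho" and "rho < pi / 2"
    and "0 \<le> Re s"
    and "modal_labelling ax ay b ky lam1 lam2"
    and "0 < Lx"
    and "continuous_on {..0} sigx" and "continuous_on {Lx..} sigx"
  shows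
    "(\<forall>th\<in>{rho, - rho}. \<forall>lam\<in>{lam1 s, lam2 s}.
        (\<forall>(x0, S) \<in> {(0, {..0}), (Lx, {Lx..})}.
           vanishing_derivs n S x0 sigx \<longrightarrow>
           matches_to_order n S x0 (u_mode lam) (u_pml ax b ky th sigx x0 lam)) \<and>
        (\<forall>(x0, S) \<in> {(0, {..<0}), (Lx, {Lx<..})}. \<forall>x\<in>S.
           (u_pml ax b ky th sigx x0 lam has_vector_derivative
              lam_tilde ax b ky th sigx lam x * u_pml ax b ky th sigx x0 lam x) (at x))) \<and>
     ((\<forall>x. x < 0 \<or> Lx < x \<longrightarrow> 0 < sigx x) \<longrightarrow>
        (\<forall>x. x < 0 \<or> Lx < x \<longrightarrow>
           (0 < ax \<longrightarrow> pml_absorbs ax ay b ky rho sigx (lam1 s) (lam2 s) x) \<and>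
           (ax < 0 \<longrightarrow> pml_absorbs ax ay b ky (- rho) sigx (lam1 s) (lam2 s) x)))"
proof (intro conjI impI allI)
  have ax: "ax \<noteq> 0"
    using \<open>ax * ay > b\<^sup>2\<close> zero_le_power2[of b] by auto
  have nontriv: "{..0 :: real} \<noteq> {c}" "{Lx..} \<noteq> {c}" for c
    using infinite_Iic[of "0 :: real"] infinite_Ici[of Lx] by (metis finite.emptyI finite.insertI)+
  have perfect: "y islimpt {..0}" if "y \<in> {..0}" for y :: real
    by (rule connected_imp_perfect[OF connected_Iic that nontriv(1)])
  have perfect': "y islimpt {Lx..}" if "y \<in> {Lx..}" for y :: real
    by (rule connected_imp_perfect[OF connected_Ici that nontriv(2)])
  have open_der: "(u_pml ax b ky th sigx x0 lam has_vector_derivative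
      lam_tilde ax b ky th sigx lam x * u_pml ax b ky th sigx x0 lam x) (at x)"
    if "is_interval S" "x0 \<in> S" "x \<in> interior S" "continuous_on S sigx" for th x0 lam x S
  proof -
    have "x \<in> S" using that(3) interior_subset by blast
    from u_pml_has_vector_derivative_within[OF that(1,2) this that(4)] show ?thesis
      unfolding at_within_interior[OF that(3)] .
  qed
  show "\<forall>th\<in>{rho, - rho}. \<forall>lam\<in>{lam1 s, lam2 s}.
        (\<forall>(x0, S) \<in> {(0, {..0}), (Lx, {Lx..})}.
           vanishing_derivs n S x0 sigx \<longrightarrow>
           matches_to_order n S x0 (u_mode lam) (u_pml ax b ky th sigx x0 lam)) \<and>
        (\<forall>(x0, S) \<in> {(0, {..<0}), (Lx, {Lx<..})}. \<forall>x\<in>S.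
           (u_pml ax b ky th sigx x0 lam has_vector_derivative
              lam_tilde ax b ky th sigx lam x * u_pml ax b ky th sigx x0 lam x) (at x))"
  proof (intro ballI conjI; clarify)
    fix th lam x0 S
    assume "(x0, S) \<in> {(0, {..0}), (Lx, {Lx..})}" and "vanishing_derivs n S x0 sigx"
    then show "matches_to_order n S x0 (u_mode lam) (u_pml ax b ky th sigx x0 lam)"
      using u_pml_matches[OF is_interval_ic perfect _ assms(8), of 0]
        u_pml_matches[OF is_interval_ci perfect' _ assms(9), of Lx] by auto
  next
    fix th lam x0 S x
    assume "(x0, S) \<in> {(0, {..<0}), (Lx, {Lx<..})}" and "x \<in> S"
    then show "(u_pml ax b ky th sigx x0 lam has_vector_derivative
        lam_tilde ax b ky th sigx lam x * u_pml ax b ky th sigx x0 lam x) (at x)"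
      using open_der[OF is_interval_ic _ _ assms(8), of 0 x]
        open_der[OF is_interval_ci _ _ assms(9), of Lx x] by auto
  qed
  have cs: "0 < cos rho" "0 < sin rho"
    using assms(3,4) by (auto intro: cos_gt_zero sin_gt_zero2)
  fix x
  assume "\<forall>x. x < 0 \<or> Lx < x \<longrightarrow> 0 < sigx x" and "x < 0 \<or> Lx < x"
  then have sig: "0 < sigx x" by blast
  show "pml_absorbs ax ay b ky rho sigx (lam1 s) (lam2 s) x" if "0 < ax"
    using pml_absorbsI[OF ax assms(6,5), of rho] cs sig that by simp
  show "pml_absorbs ax ay b ky (- rho) sigx (lam1 s) (lam2 s) x" if "ax < 0"
    using pml_absorbsI[OF ax assms(6,5), of "- rho"] cs sig that
    by (simp add: divide_pos_neg zero_less_divide_iff)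
qed

end
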